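(* The Haagerup flow on $M_n(\mathbb{C})$, i.e. the flow of the equation $\frac{dX(t)}{dt}=[[X(t)^*,X(t)],X(t)]$, is the gradient flow with respect to the energy function $E(X)=\frac14\|[X^*,X]\|_2^2=\frac14\operatorname{Tr}([X^*,X]^2)$; that is, $[[X^*,X],X]=-\operatorname{grad}E(X)$ for all $X\in M_n(\mathbb{C})$, where the gradient is taken with respect to the real inner product $\langle X,Y\rangle=\operatorname{Re}\operatorname{Tr}(Y^*X)$ on $M_n(\mathbb{C})$.
   Context: $[A,B]=AB-BA$, $\|\cdot\|_2$ is the Hilbert–Schmidt norm. $M_n(\mathbb{C})$ is viewed as a real inner product space with $\langle X,Y\rangle=\operatorname{Re}\operatorname{Tr}(Y^*X)$. The gradient flow for $E$ is the flow of $\frac{dX}{dt}=-\operatorname{grad}E(X)$. *)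

theory Defs
  imports "HOL-Analysis.Analysis"
begin

definition adj :: "complex^'n^'m \<Rightarrow> complex^'m^'n" where
  "adj A = transpose (map_matrix cnj A)"

definition comm :: "complex^'n^'n \<Rightarrow> complex^'n^'n \<Rightarrow> complex^'n^'n" where
  "comm A B = A ** B - B ** A"

definition hs_inner :: "complex^'n^'n \<Rightarrow> complex^'n^'n \<Rightarrow> real" where
  "hs_inner X Y = Re (trace (adj Y ** X))"

definition hs_norm :: "complex^'n^'n \<Rightarrow> real" where
  "hs_norm A = sqrt (hs_inner A A)"

definition energy :: "complex^'n^'n \<Rightarrow> real" where
  "energy X = 1 / 4 * (hs_norm (comm (adj X) X))\<^sup>2"

definition has_grad :: "(complex^'n^'n \<Rightarrow> real) \<Rightarrow> complex^'n^'n \<Rightarrow> complex^'n^'n \<Rightarrow> bool" where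
  "has_grad f G X \<longleftrightarrow> (f has_derivative (\<lambda>H. hs_inner H G)) (at X)"

text \<open>Only meaningful where \<open>f\<close> is differentiable.\<close>

definition grad :: "(complex^'n^'n \<Rightarrow> real) \<Rightarrow> complex^'n^'n \<Rightarrow> complex^'n^'n" where
  "grad f X = (THE G. has_grad f G X)"

text \<open>Integral curves of the autonomous vector field \<open>F\<close> on a time interval \<open>T\<close>, one-sided
  derivatives being used at endpoints belonging to \<open>T\<close>.\<close>

definition integral_curve_on ::
    "(complex^'n^'n \<Rightarrow> complex^'n^'n) \<Rightarrow> (real \<Rightarrow> complex^'n^'n) \<Rightarrow> real set \<Rightarrow> bool" where
  "integral_curve_on F x T \<longleftrightarrow>
     is_interval T \<and> (\<forall>t\<in>T. (x has_vector_derivative F (x t)) (at t within T))"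

text \<open>The inner product and norm above are the library's own on this type, so
  that \<open>has_derivative\<close> and \<open>has_vector_derivative\<close> refer to the Hilbert--Schmidt norm.\<close>

lemma hs_inner_eq_inner: "hs_inner X Y = X \<bullet> Y"
proof -
  have "hs_inner X Y = (\<Sum>i\<in>UNIV. \<Sum>k\<in>UNIV. Re (cnj (Y $ k $ i) * X $ k $ i))"
    by (simp add: hs_inner_def adj_def trace_def matrix_matrix_mult_def transpose_def)
  also have "\<dots> = (\<Sum>k\<in>UNIV. \<Sum>i\<in>UNIV. Re (cnj (Y $ k $ i) * X $ k $ i))"
    by (rule sum.swap)
  also have "\<dots> = X \<bullet> Y"
    by (simp add: inner_vec_def inner_complex_def mult.commute)
  finally show ?thesis .
qed

lemma hs_norm_eq_norm: "hs_norm A = norm A"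
  by (simp add: hs_norm_def hs_inner_eq_inner norm_eq_sqrt_inner)

lemma has_grad_iff_gderiv: "has_grad f G X \<longleftrightarrow> GDERIV f X :> G"
  by (simp add: has_grad_def gderiv_def hs_inner_eq_inner)

lemma has_grad_unique:
  assumes "has_grad f G X" "has_grad f G' X"
  shows "G = G'"
proof -
  have "(\<lambda>H. hs_inner H G) = (\<lambda>H. hs_inner H G')"
    using assms unfolding has_grad_def by (rule has_derivative_unique)
  then have "\<forall>H. H \<bullet> G = H \<bullet> G'"
    by (simp add: hs_inner_eq_inner fun_eq_iff)
  then show ?thesis
    by (simp only: vector_eq_ldot)
qed

lemma grad_eq: "has_grad f G X \<Longrightarrow> grad f X = G"
  unfolding grad_def by (rule the_equality, assumption, rule has_grad_unique)

end

theory Submission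
  imports Defs
begin

text \<open>
  Write \<open>C = [X\<^sup>*, X]\<close>, a self-adjoint matrix, so that \<open>E(X) = \<langle>C, C\<rangle> / 4\<close> and
  \<open>dE(X)(H) = \<langle>dC(H), C\<rangle> / 2\<close>. By the product rule \<open>dC(H) = [X\<^sup>*, H] + [H\<^sup>*, X]\<close>, and the two
  summands are adjoints of each other (\<open>adj_comm\<close>). Since \<open>C\<close> is self-adjoint and taking adjoints
  is an isometry, both summands have the same inner product with \<open>C\<close>, whence
  \<open>dE(X)(H) = \<langle>[X\<^sup>*, H], C\<rangle>\<close>. Finally the Hilbert--Schmidt adjoint of the operator \<open>[X\<^sup>*, \<cdot>]\<close> is
  \<open>[X, \<cdot>]\<close> (\<open>inner_comm\<close>, a consequence of the cyclicity of the trace), so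
  \<open>dE(X)(H) = \<langle>H, [X, C]\<rangle>\<close>, i.e. the gradient is \<open>[X, C] = -[C, X]\<close>.
\<close>

lemma adj_adj: "adj (adj A) = A"
  by (simp add: adj_def transpose_def vec_eq_iff)

lemma adj_diff: "adj (A - B) = adj A - adj B"
  by (simp add: adj_def transpose_def vec_eq_iff)

lemma adj_matrix_mult: "adj (A ** B) = adj B ** adj A"
  by (simp add: adj_def transpose_def vec_eq_iff matrix_matrix_mult_def mult.commute)

lemma adj_comm: "adj (comm A B) = comm (adj B) (adj A)"
  by (simp add: comm_def adj_diff adj_matrix_mult)

lemma inner_adj_adj:
  fixes A B :: "complex^'n^'n"
  shows "adj A \<bullet> adj B = A \<bullet> B"
proof -
  have "adj A \<bullet> adj B = (\<Sum>i\<in>UNIV. \<Sum>k\<in>UNIV. A $ k $ i \<bullet> B $ k $ i)"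
    by (simp add: inner_vec_def adj_def transpose_def inner_complex_def)
  also have "\<dots> = (\<Sum>k\<in>UNIV. \<Sum>i\<in>UNIV. A $ k $ i \<bullet> B $ k $ i)"
    by (rule sum.swap)
  also have "\<dots> = A \<bullet> B"
    by (simp add: inner_vec_def)
  finally show ?thesis .
qed

lemma bounded_linear_adj: "bounded_linear (adj :: complex^'n^'n \<Rightarrow> complex^'n^'n)"
  unfolding linear_conv_bounded_linear[symmetric]
  by (rule linearI) (simp_all add: adj_def transpose_def vec_eq_iff)

lemma bounded_bilinear_comm:
  "bounded_bilinear (comm :: complex^'n^'n \<Rightarrow> complex^'n^'n \<Rightarrow> complex^'n^'n)"
  unfolding bilinear_conv_bounded_bilinear[symmetric] bilinear_def
  by (auto intro!: linearI simp: comm_def matrix_matrix_mult_def vec_eq_iff algebra_simps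
      sum.distrib scaleR_sum_right)

text \<open>The trace form turns left and right multiplication by \<open>A\<close> into those by \<open>A\<^sup>*\<close>; for the
  right multiplication this is where the cyclicity of the trace enters.\<close>

lemma inner_comm:
  fixes A B C :: "complex^'n^'n"
  shows "comm A B \<bullet> C = B \<bullet> comm (adj A) C"
proof -
  have "trace (adj C ** (B ** A)) = trace (A ** adj C ** B)"
    using trace_mul_sym[of "adj C ** B" A] by (simp add: matrix_mul_assoc)
  moreover have "trace (adj C ** (A - B)) = trace (adj C ** A) - trace (adj C ** B)"
    for A B C :: "complex^'n^'n"
    by (simp add: trace_def matrix_matrix_mult_def right_diff_distrib sum_subtractf)
  moreover have "trace ((A - B) ** C) = trace (A ** C) - trace (B ** C)"
    for A B C :: "complex^'n^'n"
    by (simp add: trace_def matrix_matrix_mult_def left_diff_distrib sum_subtractf)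
  ultimately show ?thesis
    by (simp add: hs_inner_eq_inner[symmetric] hs_inner_def comm_def adj_diff adj_matrix_mult
        adj_adj matrix_mul_assoc)
qed

theorem energy_has_grad:
  fixes X :: "complex^'n^'n"
  shows "has_grad energy (- comm (comm (adj X) X) X) X"
proof -
  let ?C = "comm (adj X) X"
  have selfadj: "adj ?C = ?C"
    by (simp add: adj_comm adj_adj)
  have energy: "energy = (\<lambda>Y :: complex^'n^'n. 1 / 4 * (comm (adj Y) Y \<bullet> comm (adj Y) Y))"
    by (simp add: fun_eq_iff energy_def hs_norm_eq_norm power2_norm_eq_inner)
  have dC: "((\<lambda>Y. comm (adj Y) Y) has_derivative (\<lambda>H. comm (adj X) H + comm (adj H) X)) (at X)"
    by (rule bounded_bilinear.FDERIV[OF bounded_bilinear_comm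
          bounded_linear_imp_has_derivative[OF bounded_linear_adj] has_derivative_ident])
  have "1 / 4 * (?C \<bullet> (comm (adj X) H + comm (adj H) X)
          + (comm (adj X) H + comm (adj H) X) \<bullet> ?C)
        = H \<bullet> (- comm ?C X)" for H
  proof -
    have "comm (adj H) X \<bullet> ?C = comm (adj X) H \<bullet> ?C"
      using inner_adj_adj[of "comm (adj X) H" ?C] by (simp only: selfadj) (simp add: adj_comm adj_adj)
    moreover have "comm (adj X) H \<bullet> ?C = H \<bullet> comm X ?C"
      by (simp add: inner_comm adj_adj)
    moreover have "comm X ?C = - comm ?C X"
      by (simp add: comm_def)
    ultimately show ?thesis
      by (simp add: inner_add_left inner_add_right inner_commute[of ?C])
  qed
  then show ?thesis
    using has_derivative_mult_right[OF has_derivative_inner[OF dC dC], of "1 / 4"]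
    by (simp only: has_grad_def hs_inner_eq_inner energy)
qed

theorem propositionA2:
  shows "(\<forall>X :: complex^'n^'n.
            complex_of_real (energy X) = 1 / 4 * trace (comm (adj X) X ** comm (adj X) X)) \<and>
         (\<forall>X :: complex^'n^'n.
            energy differentiable (at X) \<and> comm (comm (adj X) X) X = - grad energy X) \<and>
         (\<forall>(x :: real \<Rightarrow> complex^'n^'n) T.
            integral_curve_on (\<lambda>X. comm (comm (adj X) X) X) x T \<longleftrightarrow>
            integral_curve_on (\<lambda>X. - grad energy X) x T)"
proof -
  have "complex_of_real (energy X) = 1 / 4 * trace (comm (adj X) X ** comm (adj X) X)"
    for X :: "complex^'n^'n"
  proof -
    let ?C = "comm (adj X) X"
    have "adj ?C = ?C"
      by (simp add: adj_comm adj_adj)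
    moreover have "complex_of_real (?C \<bullet> ?C) = trace (adj ?C ** ?C)"
    proof -
      \<comment> \<open>Only the vanishing of the imaginary part is at issue: the diagonal entries of
          \<open>C\<^sup>* C\<close> are sums of terms \<open>cnj z * z\<close>.\<close>
      have "Im (trace (adj ?C ** ?C)) = 0"
        by (simp add: trace_def matrix_matrix_mult_def adj_def transpose_def)
      then show ?thesis
        by (simp add: complex_eq_iff hs_inner_eq_inner[symmetric] hs_inner_def)
    qed
    ultimately show ?thesis
      by (simp add: energy_def hs_norm_eq_norm power2_norm_eq_inner)
  qed
  moreover have "energy differentiable (at X)" for X :: "complex^'n^'n"
    using energy_has_grad[of X] unfolding has_grad_def differentiable_def by blast
  moreover have "comm (comm (adj X) X) X = - grad energy X" for X :: "complex^'n^'n"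
    using grad_eq[OF energy_has_grad[of X]] by simp
  ultimately show ?thesis
    by simp
qed

end
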